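(* Let $\mathbf g:\mathcal Z\to\mathcal X$ generate its output via independent mechanisms (IMA) and let $\mathbf f:\mathcal X\to\mathbb R^K$ be a faithful encoder for $\mathbf g$. Let $\mathbf M\in\mathbb R^{K\times K}$ have full rank, put $\mathbf f'=\mathbf M\mathbf f$, so that $\mathbf J_{\mathbf f'}(\mathbf g(\mathbf z))=\mathbf M\mathbf J_{\mathbf f}(\mathbf g(\mathbf z))$, and write $\boldsymbol\Sigma(\mathbf z)=\mathbf J_{\mathbf f'}(\mathbf g(\mathbf z))\,\mathbf J_{\mathbf f'}(\mathbf g(\mathbf z))^\top$. Suppose that there are two points $\mathbf z_a,\mathbf z_b\in\mathcal Z$ such that $\boldsymbol\Sigma(\mathbf z_a)$ and $\boldsymbol\Sigma(\mathbf z_b)$ are both diagonal and of full rank, and such that the diagonal entries of $\boldsymbol\Sigma(\mathbf z_a)\boldsymbol\Sigma(\mathbf z_b)^{-1}$ are pairwise distinct (non-equal magnitude ratios condition). Then there exist a permutation matrix $\mathbf P\in\mathbb R^{K\times K}$ and an invertible diagonal (scaling) matrix $\mathbf S\in\mathbb R^{K\times K}$ such that, with $\mathbf e=\mathbf f(\mathbf g(\mathbf z))$, one has $\mathbf M\mathbf e=\mathbf P\mathbf S\mathbf z$ for all $\mathbf z\in\mathcal Z$.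
   Context: Setting: $K,L$ are positive integers ($L$ is thought of as much larger than $K$), $\mathcal Z\subset\mathbb R^K$ and $\mathcal X\subset\mathbb R^L$ are non-empty open sets, and $\mathbf g:\mathcal Z\to\mathcal X$, $\mathbf f:\mathcal X\to\mathbb R^K$ are maps. $\mathbf J_{\mathbf g}(\mathbf z)\in\mathbb R^{L\times K}$ and $\mathbf J_{\mathbf f}(\mathbf x)\in\mathbb R^{K\times L}$ denote Jacobian matrices; "the Jacobian exists at a point" means the map is differentiable there. A permutation matrix has exactly one entry $1$ in each row and each column and zeros elsewhere. Independent mechanisms (IMA): $\mathbf g$ generates $\mathbf x=\mathbf g(\mathbf z)$ from $\mathbf z$ via independent mechanisms if, for all $\mathbf z\in\mathcal Z$, $\mathbf J_{\mathbf g}(\mathbf z)$ exists and its columns are orthogonal, i.e. $\mathbf J_{\mathbf g}(\mathbf z)^\top\mathbf J_{\mathbf g}(\mathbf z)$ is a diagonal $K\times K$ matrix (which may depend on $\mathbf z$). Faithful encoder: $\mathbf f$ is a faithful encoder for $\mathbf g$ if (i) there is a full-rank $\mathbf D\in\mathbb R^{K\times K}$ with $\mathbf f(\mathbf g(\mathbf z))=\mathbf D\mathbf z$ for all $\mathbf z\in\mathcal Z$; and (ii) for all $\mathbf z\in\mathcal Z$, $\mathbf J_{\mathbf f}(\mathbf g(\mathbf z))$ and $\mathbf J_{\mathbf g}(\mathbf z)$ exist and $\operatorname{span}(\mathbf J_{\mathbf g}(\mathbf z))^\perp\subseteq\ker(\mathbf J_{\mathbf f}(\mathbf g(\mathbf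 z)))$, where $\operatorname{span}(\mathbf J_{\mathbf g}(\mathbf z))\subseteq\mathbb R^L$ is the linear span of the columns and $\perp$ is the orthogonal complement in $\mathbb R^L$. *)

theory Defs
  imports "HOL-Analysis.Analysis"
begin

definition is_diagonal :: "real^'n^'n \<Rightarrow> bool" where
  "is_diagonal A \<longleftrightarrow> (\<forall>i j. i \<noteq> j \<longrightarrow> A $ i $ j = 0)"

definition is_permutation_matrix :: "real^'n^'n \<Rightarrow> bool" where
  "is_permutation_matrix P \<longleftrightarrow>
     (\<forall>i j. P $ i $ j = 0 \<or> P $ i $ j = 1) \<and>
     (\<forall>i. \<exists>!j. P $ i $ j = 1) \<and> (\<forall>j. \<exists>!i. P $ i $ j = 1)"

definition full_rank :: "real^'n^'n \<Rightarrow> bool" where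
  "full_rank A \<longleftrightarrow> rank A = CARD('n)"

(* The maps are total on the ambient spaces. Differentiability and Jacobians below are only
   taken at points of open subsets, so the values of the maps elsewhere play no role. *)

definition independent_mechanisms :: "(real^'k) set \<Rightarrow> (real^'k \<Rightarrow> real^'l) \<Rightarrow> bool" where
  "independent_mechanisms Z g \<longleftrightarrow>
     (\<forall>z\<in>Z. g differentiable (at z) \<and>
            is_diagonal (transpose (jacobian g (at z)) ** jacobian g (at z)))"

definition faithful_encoder ::
    "(real^'k) set \<Rightarrow> (real^'k \<Rightarrow> real^'l) \<Rightarrow> (real^'l \<Rightarrow> real^'k) \<Rightarrow> bool" where
  "faithful_encoder Z g f \<longleftrightarrow>
     (\<exists>D :: real^'k^'k. full_rank D \<and> (\<forall>z\<in>Z. f (g z) = D *v z)) \<and>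
     (\<forall>z\<in>Z. f differentiable (at (g z)) \<and> g differentiable (at z) \<and>
            orthogonal_comp (span (columns (jacobian g (at z))))
              \<subseteq> {v. jacobian f (at (g z)) *v v = 0})"

end

theory Submission
  imports Defs
begin

text \<open>
  Let \<open>G\<close> and \<open>F\<close> be the Jacobians of \<open>g\<close> and \<open>f\<close> at a latent point. The chain rule gives
  \<open>F G = D\<close>, and since \<open>F\<close> vanishes on the orthogonal complement of the column space of \<open>G\<close>,
  it factors through the orthogonal projection onto that space: \<open>F = D (G\<^sup>T G)\<inverse> G\<^sup>T\<close>.
  With \<open>W = M D\<close> this yields \<open>\<Sigma> z = W (G\<^sup>T G)\<inverse> W\<^sup>T\<close>, where the middle factor is diagonal
  and \<open>W\<close> does not depend on \<open>z\<close>. Comparing the two points, \<open>\<Lambda> = \<Sigma> z\<^sub>a (\<Sigma> z\<^sub>b)\<inverse>\<close> satisfies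
  \<open>\<Lambda> W = W C\<close> with \<open>C\<close> diagonal. As the entries of \<open>\<Lambda>\<close> are distinct, each column of
  \<open>W\<close> has at most one non-zero entry, so the invertible matrix \<open>W\<close> is a scaled permutation.
\<close>

lemma full_rank_imp_invertible:
  fixes A :: "real^'n^'n"
  assumes "full_rank A"
  shows "invertible A"
  using assms unfolding full_rank_def
  by (metis invertible_left_inverse matrix_left_invertible_injective full_rank_injective)

text \<open>\<open>matrix_inv\<close> is a Hilbert choice, so invertibility supplies the witness
  behind both identities.\<close>

lemma matrix_inv_mult:
  fixes A :: "real^'n^'n"
  assumes "invertible A"
  shows "A ** matrix_inv A = mat 1" and "matrix_inv A ** A = mat 1"
  using someI_ex[OF assms[unfolded invertible_def]] by (simp_all add: matrix_inv_def)

lemma matrix_mult_cancel_right: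
  fixes A B :: "real^'n^'m" and C :: "real^'n^'n"
  assumes "invertible C" and "A ** C = B ** C"
  shows "A = B"
  by (metis assms matrix_inv_mult(1) matrix_mul_assoc matrix_mul_rid)

lemma diagonal_mult_left_nth:
  fixes A :: "real^'n^'n" and B :: "real^'m^'n"
  assumes "is_diagonal A"
  shows "(A ** B) $ i $ j = A $ i $ i * B $ i $ j"
proof -
  have "(A ** B) $ i $ j = (\<Sum>k\<in>UNIV. A $ i $ k * B $ k $ j)"
    by (simp add: matrix_matrix_mult_def)
  also have "\<dots> = (\<Sum>k\<in>UNIV. if k = i then A $ i $ i * B $ i $ j else 0)"
    by (rule sum.cong) (use assms in \<open>auto simp: is_diagonal_def\<close>)
  finally show ?thesis by simp
qed

lemma diagonal_mult_right_nth:
  fixes A :: "real^'n^'n" and B :: "real^'n^'m"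
  assumes "is_diagonal A"
  shows "(B ** A) $ i $ j = B $ i $ j * A $ j $ j"
proof -
  have "(B ** A) $ i $ j = (\<Sum>k\<in>UNIV. B $ i $ k * A $ k $ j)"
    by (simp add: matrix_matrix_mult_def)
  also have "\<dots> = (\<Sum>k\<in>UNIV. if k = j then B $ i $ j * A $ j $ j else 0)"
    by (rule sum.cong) (use assms in \<open>auto simp: is_diagonal_def\<close>)
  finally show ?thesis by simp
qed

lemma diagonal_mult_vec_nth:
  fixes A :: "real^'n^'n"
  assumes "is_diagonal A"
  shows "(A *v x) $ i = A $ i $ i * x $ i"
proof -
  have "(A *v x) $ i = (\<Sum>k\<in>UNIV. A $ i $ k * x $ k)"
    by (simp add: matrix_vector_mult_def)
  also have "\<dots> = (\<Sum>k\<in>UNIV. if k = i then A $ i $ i * x $ i else 0)"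
    by (rule sum.cong) (use assms in \<open>auto simp: is_diagonal_def\<close>)
  finally show ?thesis by simp
qed

lemma is_diagonal_mult:
  assumes "is_diagonal A" and "is_diagonal B"
  shows "is_diagonal (A ** B)"
  unfolding is_diagonal_def diagonal_mult_left_nth[OF assms(1)]
  using assms(2) by (simp add: is_diagonal_def)

lemma invertible_diagonal_nth:
  assumes "is_diagonal A" and "invertible A"
  shows "A $ i $ i \<noteq> 0"
proof -
  have "A $ i $ i * matrix_inv A $ i $ i = 1"
    using matrix_inv_mult(1)[OF assms(2)] diagonal_mult_left_nth[OF assms(1), of "matrix_inv A" i i]
    by (simp add: mat_def)
  then show ?thesis by auto
qed

text \<open>Row \<open>i\<close> of \<open>A ** matrix_inv A\<close> is row \<open>i\<close> of
  \<open>matrix_inv A\<close> scaled by the non-zero \<open>A $ i $ i\<close>; being a row of the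
  identity, it vanishes off the diagonal.\<close>

lemma is_diagonal_matrix_inv:
  assumes "is_diagonal A" and "invertible A"
  shows "is_diagonal (matrix_inv A)"
  unfolding is_diagonal_def
proof (intro allI impI)
  fix i j :: 'a assume "i \<noteq> j"
  then have "A $ i $ i * matrix_inv A $ i $ j = 0"
    using matrix_inv_mult(1)[OF assms(2)] diagonal_mult_left_nth[OF assms(1), of "matrix_inv A" i j]
    by (simp add: mat_def)
  then show "matrix_inv A $ i $ j = 0"
    using invertible_diagonal_nth[OF assms] by simp
qed

lemma invertible_matrix_inv:
  fixes A :: "real^'n^'n"
  assumes "invertible A"
  shows "invertible (matrix_inv A)"
  using matrix_inv_mult[OF assms] unfolding invertible_def by blast

lemma invertible_diagonal_nonzero:
  assumes "is_diagonal A" and "\<And>i. A $ i $ i \<noteq> 0"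
  shows "invertible A"
proof -
  have "inj ((*v) A)"
  proof (rule injI)
    fix x y assume "A *v x = A *v y"
    then have "A $ i $ i * x $ i = A $ i $ i * y $ i" for i
      by (metis diagonal_mult_vec_nth[OF assms(1)])
    then show "x = y" using assms(2) by (simp add: vec_eq_iff)
  qed
  then show ?thesis
    by (metis invertible_left_inverse matrix_left_invertible_injective)
qed

text \<open>A zero column or a zero row would put a 0 on the diagonal of \<open>V ** W\<close> or
  \<open>W ** V\<close>. Hence each column has exactly one non-zero entry, and the map
  \<open>p\<close> from columns to the rows of these entries is onto, thus bijective by
  finiteness.\<close>

lemma monomial_matrix_decomposition:
  fixes W :: "real^'n^'n"
  assumes "invertible W"
    and col: "\<And>i i' j. W $ i $ j \<noteq> 0 \<Longrightarrow> W $ i' $ j \<noteq> 0 \<Longrightarrow> i = i'"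
  obtains P S :: "real^'n^'n"
  where "is_permutation_matrix P" and "is_diagonal S" and "invertible S" and "W = P ** S"
proof -
  define V where "V = matrix_inv W"
  have "\<exists>i. W $ i $ j \<noteq> 0" for j
  proof (rule ccontr)
    assume "\<nexists>i. W $ i $ j \<noteq> 0"
    then have "(V ** W) $ j $ j = 0" by (simp add: matrix_matrix_mult_def)
    then show False using matrix_inv_mult(2)[OF assms(1)] by (simp add: V_def mat_def)
  qed
  then obtain p where p: "W $ (p j) $ j \<noteq> 0" for j by metis
  have zero: "W $ i $ j = 0" if "i \<noteq> p j" for i j using col p that by blast
  have "surj p"
  proof (rule ccontr)
    assume "\<not> surj p"
    then obtain i where "i \<notin> range p" by blast
    then have "W $ i $ j = 0" for j using zero by blast
    then have "(W ** V) $ i $ i = 0" by (simp add: matrix_matrix_mult_def)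
    then show False using matrix_inv_mult(1)[OF assms(1)] by (simp add: V_def mat_def)
  qed
  then have "bij p" by (simp add: bij_def finite_UNIV_surj_inj)
  \<comment> \<open>Since \<open>S\<close> acts first, it is indexed by columns of \<open>W\<close>;
    \<open>P\<close> then moves coordinate \<open>j\<close> to position \<open>p j\<close>.\<close>
  define P :: "real^'n^'n" where "P = (\<chi> i j. if i = p j then 1 else 0)"
  define S :: "real^'n^'n" where "S = (\<chi> i j. if i = j then W $ (p j) $ j else 0)"
  have "is_permutation_matrix P"
    unfolding is_permutation_matrix_def P_def
    using \<open>bij p\<close>[unfolded bij_iff] by (simp add: eq_commute[of _ "p _"])
  moreover have diag: "is_diagonal S" by (simp add: is_diagonal_def S_def)
  moreover have "invertible S"
    by (rule invertible_diagonal_nonzero[OF diag]) (simp add: S_def p)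
  moreover have "W = P ** S"
    unfolding vec_eq_iff diagonal_mult_right_nth[OF diag] by (auto simp: P_def S_def zero)
  ultimately show thesis by (rule that)
qed

text \<open>\<open>F\<close> is \<open>D\<close> times the Moore-Penrose pseudoinverse of
  \<open>G\<close>: the two agree on the column space of \<open>G\<close> by \<open>FG\<close>, and
  both vanish on its orthogonal complement.\<close>

lemma gram_of_pseudoinverse:
  fixes F :: "real^'l^'k" and G :: "real^'k^'l" and D :: "real^'k^'k"
  assumes FG: "F ** G = D" and "invertible D"
    and ker: "orthogonal_comp (span (columns G)) \<subseteq> {v. F *v v = 0}"
  shows "invertible (transpose G ** G)"
    and "F ** transpose F = D ** matrix_inv (transpose G ** G) ** transpose D"
proof -
  let ?A = "transpose G ** G" and ?B = "matrix_inv (transpose G ** G)"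
  show inv: "invertible ?A"
    unfolding invertible_left_inverse matrix_left_invertible_ker
  proof (intro allI impI)
    fix x assume "?A *v x = 0"
    \<comment> \<open>Pairing \<open>?A *v x = 0\<close> with \<open>x\<close> yields the squared
      norm of \<open>G *v x\<close>, so the Gram matrix and \<open>G\<close> have the same kernel;
      it is trivial because \<open>F ** G\<close> is invertible.\<close>
    then have "(G *v x) \<bullet> (G *v x) = 0"
      using dot_lmul_matrix[of "G *v x" G x]
      by (simp flip: matrix_vector_mul_assoc transpose_matrix_vector)
    then have "G *v x = 0" by simp
    then have "D *v x = 0" by (metis FG matrix_vector_mul_assoc matrix_vector_mult_0_right)
    then show "x = 0"
      using \<open>invertible D\<close> by (metis invertible_left_inverse matrix_left_invertible_ker)
  qed
  have F: "F = D ** ?B ** transpose G"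
  proof (rule matrix_eq[THEN iffD2], rule allI)
    fix v
    \<comment> \<open>The residual of \<open>v\<close> after orthogonal projection onto the column
      space of \<open>G\<close>.\<close>
    define w where "w = v - G *v (?B *v (transpose G *v v))"
    have "transpose G *v w = transpose G *v v - (?A ** ?B) *v (transpose G *v v)"
      by (simp add: w_def matrix_vector_mult_diff_distrib matrix_vector_mul_assoc matrix_mul_assoc)
    then have "transpose G *v w = 0" by (simp add: matrix_inv_mult(1)[OF inv])
    then have "column i G \<bullet> w = 0" for i
      using matrix_vector_mul_component[of "transpose G" w i]
      by (simp add: transpose_def column_def)
    then have "\<forall>c\<in>columns G. orthogonal w c"
      by (auto simp: columns_def orthogonal_def inner_commute)
    then have "w \<in> orthogonal_comp (span (columns G))"
      using orthogonal_to_span by (fastforce simp: orthogonal_comp_def orthogonal_commute)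
    then have "F *v w = 0" using ker by blast
    then have "F *v v = (F ** G) *v (?B *v (transpose G *v v))"
      by (simp add: w_def matrix_vector_mult_diff_distrib matrix_vector_mul_assoc matrix_mul_assoc)
    then show "F *v v = (D ** ?B ** transpose G) *v v"
      by (simp add: FG flip: matrix_vector_mul_assoc)
  qed
  have "transpose (F ** G) = transpose G ** transpose F" by (rule matrix_transpose_mul)
  then show "F ** transpose F = D ** ?B ** transpose D"
    \<comment> \<open>Expanding only the left factor \<open>F\<close> leaves
      \<open>transpose G ** transpose F\<close>, which is \<open>transpose D\<close>.\<close>
    by (metis F FG matrix_mul_assoc)
qed

lemma jacobian_eqI:
  fixes f :: "real^'n \<Rightarrow> real^'m"
  assumes "(f has_derivative (\<lambda>h. A *v h)) (at x)"
  shows "jacobian f (at x) = A"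
  using frechet_derivative_at[OF assms] by (metis jacobian_def matrix_of_matrix_vector_mul)

text \<open>All dependence on \<open>z\<close> sits in \<open>B\<close>, the inverse Gram matrix of
  the Jacobian of \<open>g\<close>. \<open>D\<close> is a parameter so that different points share
  the factor \<open>M ** D\<close>.\<close>

lemma jacobian_encoder:
  fixes g :: "real^'k \<Rightarrow> real^'l" and f :: "real^'l \<Rightarrow> real^'k" and D M :: "real^'k^'k"
  assumes "independent_mechanisms Z g" and "faithful_encoder Z g f" and "open Z" and "z \<in> Z"
    and D: "invertible D" "\<forall>z\<in>Z. f (g z) = D *v z"
  defines "F \<equiv> jacobian (\<lambda>x. M *v f x) (at (g z))"
  obtains B :: "real^'k^'k" where "is_diagonal B" and "invertible B"
    and "F ** transpose F = (M ** D) ** B ** transpose (M ** D)"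
proof -
  let ?F = "jacobian f (at (g z))" and ?G = "jacobian g (at z)"
  let ?B = "matrix_inv (transpose ?G ** ?G)"
  have f: "(f has_derivative (\<lambda>h. ?F *v h)) (at (g z))"
    and g: "(g has_derivative (\<lambda>h. ?G *v h)) (at z)"
    and ker: "orthogonal_comp (span (columns ?G)) \<subseteq> {v. ?F *v v = 0}"
    using assms(2,4) by (auto simp: faithful_encoder_def jacobian_works)
  have "((\<lambda>z. f (g z)) has_derivative (\<lambda>h. (?F ** ?G) *v h)) (at z)"
    using diff_chain_at[OF g f] by (simp add: o_def matrix_vector_mul_assoc)
  \<comment> \<open>The composite equals the linear map \<open>D\<close> on a whole neighbourhood of
    \<open>z\<close>, as \<open>Z\<close> is open.\<close>
  moreover have "((\<lambda>z. f (g z)) has_derivative (\<lambda>h. D *v h)) (at z)"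
    by (rule has_derivative_transform_within_open[OF _ assms(3,4)])
      (use D(2) in \<open>auto intro: bounded_linear_imp_has_derivative matrix_vector_mul_bounded_linear\<close>)
  ultimately have FG: "?F ** ?G = D" by (metis jacobian_eqI)
  note gram = gram_of_pseudoinverse[OF FG D(1) ker]
  have "is_diagonal (transpose ?G ** ?G)"
    using assms(1,4) by (auto simp: independent_mechanisms_def)
  then have "is_diagonal ?B" "invertible ?B"
    using gram(1) by (simp_all add: is_diagonal_matrix_inv invertible_matrix_inv)
  moreover have "((\<lambda>x. M *v f x) has_derivative (\<lambda>h. (M ** ?F) *v h)) (at (g z))"
    using bounded_linear.has_derivative[OF matrix_vector_mul_bounded_linear f]
    by (simp add: matrix_vector_mul_assoc)
  then have "F = M ** ?F" unfolding F_def by (rule jacobian_eqI)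
  then have "F ** transpose F = M ** (?F ** transpose ?F) ** transpose M"
    by (simp add: matrix_transpose_mul matrix_mul_assoc)
  then have "F ** transpose F = (M ** D) ** ?B ** transpose (M ** D)"
    unfolding gram(2) by (simp add: matrix_transpose_mul matrix_mul_assoc)
  ultimately show thesis by (rule that)
qed

text \<open>Cancelling \<open>transpose W\<close> leaves
  \<open>\<Lambda> ** W ** B = W ** A\<close>. Entrywise, a non-zero \<open>W $ i $ j\<close> forces
  \<open>\<Lambda> $ i $ i\<close> to be \<open>A $ j $ j / B $ j $ j\<close>, which depends on
  \<open>j\<close> alone.\<close>

lemma column_support_of_simultaneous_diagonalization:
  fixes W :: "real^'n^'n"
  assumes "invertible W" and "is_diagonal A" and "is_diagonal B" and "invertible B"
    and "is_diagonal (W ** A ** transpose W)"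
    and "is_diagonal (W ** B ** transpose W)" and "invertible (W ** B ** transpose W)"
    and "\<Lambda> = (W ** A ** transpose W) ** matrix_inv (W ** B ** transpose W)"
    and distinct: "\<And>i i'. i \<noteq> i' \<Longrightarrow> \<Lambda> $ i $ i \<noteq> \<Lambda> $ i' $ i'"
    and "W $ i $ j \<noteq> 0" and "W $ i' $ j \<noteq> 0"
  shows "i = i'"
proof -
  have \<Lambda>: "is_diagonal \<Lambda>"
    using assms(5-8) by (simp add: is_diagonal_mult is_diagonal_matrix_inv)
  have "\<Lambda> ** (W ** B ** transpose W) = W ** A ** transpose W"
    unfolding assms(8) by (metis assms(7) matrix_inv_mult(2) matrix_mul_assoc matrix_mul_rid)
  then have "(\<Lambda> ** (W ** B)) ** transpose W = (W ** A) ** transpose W"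
    by (simp add: matrix_mul_assoc)
  then have "\<Lambda> ** (W ** B) = W ** A"
    by (rule matrix_mult_cancel_right[rotated]) (simp add: assms(1) transpose_invertible)
  then have "\<Lambda> $ i $ i * (W $ i $ j * B $ j $ j) = W $ i $ j * A $ j $ j" for i
    by (metis diagonal_mult_left_nth[OF \<Lambda>] diagonal_mult_right_nth assms(2,3))
  then have "\<Lambda> $ i $ i * B $ j $ j = A $ j $ j" if "W $ i $ j \<noteq> 0" for i
    using that by (metis mult.left_commute mult_left_cancel)
  then have "\<Lambda> $ i $ i = \<Lambda> $ i' $ i'"
    using assms(10,11) invertible_diagonal_nth[OF assms(3,4)] by (metis mult_right_cancel)
  then show ?thesis using distinct by blast
qed

theorem theorem3p4:
  fixes Z :: "(real^'k) set" and X :: "(real^'l) set"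
    and g :: "real^'k \<Rightarrow> real^'l" and f f' :: "real^'l \<Rightarrow> real^'k"
    and M :: "real^'k^'k" and \<Sigma> :: "real^'k \<Rightarrow> real^'k^'k"
    and z\<^sub>a z\<^sub>b :: "real^'k"
  assumes "open Z" and "Z \<noteq> {}" and "open X" and "X \<noteq> {}"
    and "g ` Z \<subseteq> X"
    and "independent_mechanisms Z g"
    and "faithful_encoder Z g f"
    and "full_rank M"
    and "f' = (\<lambda>x. M *v f x)"
    and "\<Sigma> = (\<lambda>z. jacobian f' (at (g z)) ** transpose (jacobian f' (at (g z))))"
    and "z\<^sub>a \<in> Z" and "z\<^sub>b \<in> Z"
    and "is_diagonal (\<Sigma> z\<^sub>a)" and "full_rank (\<Sigma> z\<^sub>a)"
    and "is_diagonal (\<Sigma> z\<^sub>b)" and "full_rank (\<Sigma> z\<^sub>b)"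
    and "\<forall>i j. i \<noteq> j \<longrightarrow>
           (\<Sigma> z\<^sub>a ** matrix_inv (\<Sigma> z\<^sub>b)) $ i $ i \<noteq> (\<Sigma> z\<^sub>a ** matrix_inv (\<Sigma> z\<^sub>b)) $ j $ j"
  shows "\<exists>P S :: real^'k^'k. is_permutation_matrix P \<and> is_diagonal S \<and> invertible S \<and>
           (\<forall>z\<in>Z. M *v f (g z) = (P ** S) *v z)"
proof -
  \<comment> \<open>\<open>D\<close> is fixed before the two points are treated, so both matrices
    \<open>\<Sigma>\<close> factor through one \<open>W\<close>, which is also the matrix of the map
    from \<open>z\<close> to \<open>M *v f (g z)\<close>.\<close>
  obtain D :: "real^'k^'k" where D: "full_rank D" "\<forall>z\<in>Z. f (g z) = D *v z"
    using \<open>faithful_encoder Z g f\<close> by (auto simp: faithful_encoder_def)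
  define W where "W = M ** D"
  have invD: "invertible D" and W: "invertible W"
    using D(1) \<open>full_rank M\<close> by (simp_all add: W_def full_rank_imp_invertible invertible_mult)
  have \<Sigma>: "\<exists>B. is_diagonal B \<and> invertible B \<and> \<Sigma> z = W ** B ** transpose W" if "z \<in> Z" for z
    using jacobian_encoder[OF assms(6,7,1) that invD D(2), of M] unfolding assms(9,10) W_def by metis
  obtain A where A: "is_diagonal A" "\<Sigma> z\<^sub>a = W ** A ** transpose W"
    using \<Sigma>[OF \<open>z\<^sub>a \<in> Z\<close>] by blast
  obtain B where B: "is_diagonal B" "invertible B" "\<Sigma> z\<^sub>b = W ** B ** transpose W"
    using \<Sigma>[OF \<open>z\<^sub>b \<in> Z\<close>] by blast
  have invb: "invertible (W ** B ** transpose W)"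
    using full_rank_imp_invertible[OF assms(16)] B(3) by simp
  have col: "i = i'" if "W $ i $ j \<noteq> 0" "W $ i' $ j \<noteq> 0" for i i' j
  \<comment> \<open>\<open>refl\<close> instantiates \<open>\<Lambda>\<close> to the product of
    \<open>\<Sigma> z\<^sub>a\<close> with the inverse of \<open>\<Sigma> z\<^sub>b\<close>, written
    in factored form.\<close>
  proof (rule column_support_of_simultaneous_diagonalization[OF W A(1) B(1,2) _ _ invb refl _ that])
    show "is_diagonal (W ** A ** transpose W)" "is_diagonal (W ** B ** transpose W)"
      using assms(13,15) A(2) B(3) by simp_all
  qed (use assms(17) A(2) B(3) in simp)
  obtain P S where "is_permutation_matrix P" "is_diagonal S" "invertible S" "W = P ** S"
    by (rule monomial_matrix_decomposition[OF W col])
  moreover have "\<forall>z\<in>Z. M *v f (g z) = W *v z"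
    using D(2) by (simp add: W_def matrix_vector_mul_assoc)
  ultimately show ?thesis by metis
qed

end
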